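(* Let $(\Xi,\rho,\theta,\Sigma)$ be a continuous groupoid action with both $\Xi$ and $\Sigma$ locally compact. If all the orbits are closed, the action is semisimple. If the action is pointwise almost periodic, it is semisimple. If $\Xi$ is open and all the orbits are compact, the action is pointwise almost periodic.
   Context: All topological spaces are Hausdorff. A groupoid $\Xi$ is a small category in which all arrows are invertible; $X=\Xi^{(0)}$ is its unit space, $d,r:\Xi\to X$ are the source and range maps, and $\xi\eta$ is defined iff $d(\xi)=r(\eta)$. A topological groupoid is a groupoid with a (Hausdorff) topology making inversion and multiplication continuous (composable pairs carry the topology induced from $\Xi\times\Xi$); $X$ has the subspace topology. $\Xi$ is called open if $d:\Xi\to X$ is an open map. For $x\in X$, $\Xi_x=d^{-1}(\{x\})$. For $\mathsf A,\mathsf B\subset\Xi$, $\mathsf A\mathsf B=\{\xi\eta:\xi\in\mathsf A,\ \eta\in\mathsf B,\ d(\xi)=r(\eta)\}$. A continuous groupoid action $(\Xi,\rho,\theta,\Sigma)$ consists of a topological groupoid $\Xi$, a Hausdorff space $\Sigma$, a continuous surjection $\rho:\Sigma\to X$ (the anchor) and a continuous map $\theta:\{(\xi,\sigma)\in\Xi\times\Sigma: d(\xi)=\rho(\sigma)\}\to\Sigma$, $\theta_\xi(\sigma)=\xi\bullet\sigma$, with $\rho(\sigma)\bullet\sigma=\sigma$ and: if $d(\xi)=r(\eta)$ and $d(\eta)=\rho(\sigma)$ then $d(\xi)=\rho(\eta\bullet\sigma)$ and $(\xi\eta)\bullet\sigma=\xi\bullet(\eta\bullet\sigma)$. A subset $M\subset\Sigma$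 is invariant if $\xi\bullet\tau\in M$ whenever $\tau\in M$ and $d(\xi)=\rho(\tau)$. The orbit of $\sigma$ is $\mathfrak O_\sigma=\{\xi\bullet\sigma:\xi\in\Xi_{\rho(\sigma)}\}$; its closure $\overline{\mathfrak O}_\sigma$ is an orbit closure. A non-empty closed invariant subset $M\subset\Sigma$ is minimal if it contains no proper non-void closed invariant subset. The action is semisimple if all the orbit closures are minimal. A subset $\mathsf A\subset\Xi_x$ is syndetic (in $\Xi_x$) if $\mathsf K\mathsf A=\Xi_x$ for some compact $\mathsf K\subset\Xi$. The point $\sigma$ is almost periodic if $\widetilde\Xi_\sigma^U=\{\xi\in\Xi_{\rho(\sigma)}:\xi\bullet\sigma\in U\}$ is syndetic in $\Xi_{\rho(\sigma)}$ for every neighborhood $U$ of $\sigma$. The action is pointwise almost periodic if all points of $\Sigma$ are almost periodic. *)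

theory Defs
  imports "HOL-Analysis.Analysis"
begin

text \<open>
  A groupoid is given by its arrows only: objects are identified with the identity arrows,
  so source and range are maps from arrows to arrows.  The set of arrows is the
  \<^const>\<open>topspace\<close> of the topology; all operations are unconstrained elsewhere, and
  \<open>mul\<close> is unconstrained on non-composable pairs.
\<close>

record 'g gpd =
  gtop :: "'g topology"
  src :: "'g \<Rightarrow> 'g"
  rng :: "'g \<Rightarrow> 'g"
  mul :: "'g \<Rightarrow> 'g \<Rightarrow> 'g"
  ginv :: "'g \<Rightarrow> 'g"

definition arrows :: "'g gpd \<Rightarrow> 'g set" where
  "arrows G = topspace (gtop G)"

definition units :: "'g gpd \<Rightarrow> 'g set" where
  "units G = src G ` arrows G"

definition composable :: "'g gpd \<Rightarrow> ('g \<times> 'g) set" where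
  "composable G = {(x, y). x \<in> arrows G \<and> y \<in> arrows G \<and> src G x = rng G y}"

definition unit_top :: "'g gpd \<Rightarrow> 'g topology" where
  "unit_top G = subtopology (gtop G) (units G)"

locale groupoid =
  fixes G :: "'g gpd"
  assumes src_closed: "x \<in> arrows G \<Longrightarrow> src G x \<in> arrows G"
    and rng_unit: "x \<in> arrows G \<Longrightarrow> rng G x \<in> units G"
    and src_of_unit: "u \<in> units G \<Longrightarrow> src G u = u"
    and rng_of_unit: "u \<in> units G \<Longrightarrow> rng G u = u"
    and mul_closed: "(x, y) \<in> composable G \<Longrightarrow> mul G x y \<in> arrows G"
    and src_mul: "(x, y) \<in> composable G \<Longrightarrow> src G (mul G x y) = src G y"
    and rng_mul: "(x, y) \<in> composable G \<Longrightarrow> rng G (mul G x y) = rng G x"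
    and mul_assoc: "(x, y) \<in> composable G \<Longrightarrow> (y, z) \<in> composable G \<Longrightarrow>
      mul G (mul G x y) z = mul G x (mul G y z)"
    and mul_unit_left: "x \<in> arrows G \<Longrightarrow> mul G (rng G x) x = x"
    and mul_unit_right: "x \<in> arrows G \<Longrightarrow> mul G x (src G x) = x"
    and inv_closed: "x \<in> arrows G \<Longrightarrow> ginv G x \<in> arrows G"
    and src_inv: "x \<in> arrows G \<Longrightarrow> src G (ginv G x) = rng G x"
    and rng_inv: "x \<in> arrows G \<Longrightarrow> rng G (ginv G x) = src G x"
    and mul_inv_right: "x \<in> arrows G \<Longrightarrow> mul G x (ginv G x) = rng G x"
    and mul_inv_left: "x \<in> arrows G \<Longrightarrow> mul G (ginv G x) x = src G x"

locale topological_groupoid = groupoid +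
  assumes Hausdorff_arrows: "Hausdorff_space (gtop G)"
    and continuous_inv: "continuous_map (gtop G) (gtop G) (ginv G)"
    and continuous_mul:
      "continuous_map (subtopology (prod_topology (gtop G) (gtop G)) (composable G)) (gtop G)
         (\<lambda>(x, y). mul G x y)"

definition open_groupoid :: "'g gpd \<Rightarrow> bool" where
  "open_groupoid G \<longleftrightarrow> open_map (gtop G) (unit_top G) (src G)"

definition src_fibre :: "'g gpd \<Rightarrow> 'g \<Rightarrow> 'g set" where
  "src_fibre G x = {\<xi> \<in> arrows G. src G \<xi> = x}"

definition set_mul :: "'g gpd \<Rightarrow> 'g set \<Rightarrow> 'g set \<Rightarrow> 'g set" where
  "set_mul G A B = {mul G \<xi> \<eta> |\<xi> \<eta>. \<xi> \<in> A \<and> \<eta> \<in> B \<and> src G \<xi> = rng G \<eta>}"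

definition syndetic :: "'g gpd \<Rightarrow> 'g \<Rightarrow> 'g set \<Rightarrow> bool" where
  "syndetic G x A \<longleftrightarrow>
     A \<subseteq> src_fibre G x \<and> (\<exists>K. compactin (gtop G) K \<and> set_mul G K A = src_fibre G x)"

record ('g, 's) gpd_action =
  stop :: "'s topology"
  anchor :: "'s \<Rightarrow> 'g"
  act :: "'g \<Rightarrow> 's \<Rightarrow> 's"

definition points :: "('g, 's) gpd_action \<Rightarrow> 's set" where
  "points S = topspace (stop S)"

definition actable :: "'g gpd \<Rightarrow> ('g, 's) gpd_action \<Rightarrow> ('g \<times> 's) set" where
  "actable G S = {(\<xi>, \<sigma>). \<xi> \<in> arrows G \<and> \<sigma> \<in> points S \<and> src G \<xi> = anchor S \<sigma>}"

locale continuous_groupoid_action = topological_groupoid G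
  for G :: "'g gpd" +
  fixes S :: "('g, 's) gpd_action"
  assumes Hausdorff_points: "Hausdorff_space (stop S)"
    and continuous_anchor: "continuous_map (stop S) (unit_top G) (anchor S)"
    and anchor_surj: "anchor S ` points S = units G"
    and continuous_act:
      "continuous_map (subtopology (prod_topology (gtop G) (stop S)) (actable G S)) (stop S)
         (\<lambda>(\<xi>, \<sigma>). act S \<xi> \<sigma>)"
    and act_unit: "\<sigma> \<in> points S \<Longrightarrow> act S (anchor S \<sigma>) \<sigma> = \<sigma>"
    and anchor_act: "(\<xi>, \<eta>) \<in> composable G \<Longrightarrow> (\<eta>, \<sigma>) \<in> actable G S \<Longrightarrow>
      src G \<xi> = anchor S (act S \<eta> \<sigma>)"
    and act_mul: "(\<xi>, \<eta>) \<in> composable G \<Longrightarrow> (\<eta>, \<sigma>) \<in> actable G S \<Longrightarrow>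
      act S (mul G \<xi> \<eta>) \<sigma> = act S \<xi> (act S \<eta> \<sigma>)"

definition invariant :: "'g gpd \<Rightarrow> ('g, 's) gpd_action \<Rightarrow> 's set \<Rightarrow> bool" where
  "invariant G S M \<longleftrightarrow>
     M \<subseteq> points S \<and>
     (\<forall>\<xi> \<in> arrows G. \<forall>\<tau> \<in> M. src G \<xi> = anchor S \<tau> \<longrightarrow> act S \<xi> \<tau> \<in> M)"

definition orbit :: "'g gpd \<Rightarrow> ('g, 's) gpd_action \<Rightarrow> 's \<Rightarrow> 's set" where
  "orbit G S \<sigma> = {act S \<xi> \<sigma> |\<xi>. \<xi> \<in> src_fibre G (anchor S \<sigma>)}"

definition orbit_closure :: "'g gpd \<Rightarrow> ('g, 's) gpd_action \<Rightarrow> 's \<Rightarrow> 's set" where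
  "orbit_closure G S \<sigma> = (stop S) closure_of (orbit G S \<sigma>)"

definition minimal :: "'g gpd \<Rightarrow> ('g, 's) gpd_action \<Rightarrow> 's set \<Rightarrow> bool" where
  "minimal G S M \<longleftrightarrow>
     M \<noteq> {} \<and> closedin (stop S) M \<and> invariant G S M \<and>
     \<not> (\<exists>N. N \<subset> M \<and> N \<noteq> {} \<and> closedin (stop S) N \<and> invariant G S N)"

text \<open>
  Since \<^const>\<open>minimal\<close> contains invariance, semisimplicity asserts in particular that orbit
  closures are invariant.  This is not automatic unless the groupoid is open.
\<close>

definition semisimple :: "'g gpd \<Rightarrow> ('g, 's) gpd_action \<Rightarrow> bool" where
  "semisimple G S \<longleftrightarrow> (\<forall>\<sigma> \<in> points S. minimal G S (orbit_closure G S \<sigma>))"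

definition nbhd :: "'a topology \<Rightarrow> 'a \<Rightarrow> 'a set \<Rightarrow> bool" where
  "nbhd T a U \<longleftrightarrow> U \<subseteq> topspace T \<and> (\<exists>V. openin T V \<and> a \<in> V \<and> V \<subseteq> U)"

definition return_set :: "'g gpd \<Rightarrow> ('g, 's) gpd_action \<Rightarrow> 's \<Rightarrow> 's set \<Rightarrow> 'g set" where
  "return_set G S \<sigma> U = {\<xi> \<in> src_fibre G (anchor S \<sigma>). act S \<xi> \<sigma> \<in> U}"

definition almost_periodic :: "'g gpd \<Rightarrow> ('g, 's) gpd_action \<Rightarrow> 's \<Rightarrow> bool" where
  "almost_periodic G S \<sigma> \<longleftrightarrow>
     (\<forall>U. nbhd (stop S) \<sigma> U \<longrightarrow> syndetic G (anchor S \<sigma>) (return_set G S \<sigma> U))"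

definition pointwise_almost_periodic :: "'g gpd \<Rightarrow> ('g, 's) gpd_action \<Rightarrow> bool" where
  "pointwise_almost_periodic G S \<longleftrightarrow> (\<forall>\<sigma> \<in> points S. almost_periodic G S \<sigma>)"

end

theory Submission
  imports Defs
begin

text \<open>
  Two observations give semisimplicity in the first two cases.

  First, orbits partition the space, so an orbit has no proper non-empty invariant subset.
  A closed orbit is therefore a minimal set, which settles the case of closed orbits.

  Second, almost periodicity makes the relation "lies in the orbit closure of" symmetric. Let
  \<open>\<sigma>\<close> be almost periodic and let \<open>U\<close> be a compact neighbourhood of \<open>\<sigma>\<close>. A compact set
  \<open>K\<close> of arrows witnessing that the return set of \<open>U\<close> is syndetic gives
  \<open>orbit G S \<sigma> \<subseteq> K \<bullet> U\<close>. Since \<open>K \<bullet> U\<close> is compact, hence closed, it also contains the orbit closure.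
  So a point \<open>\<tau>\<close> of the orbit closure can be written as \<open>k \<bullet> u\<close> with \<open>u \<in> U\<close>, and \<open>u\<close> is then
  a point of the orbit of \<open>\<tau>\<close> in \<open>U\<close>. As \<open>U\<close> is arbitrarily small, \<open>\<sigma>\<close> lies in the orbit
  closure of \<open>\<tau>\<close> (\<open>orbit_closure_sym\<close>). If all points are almost periodic, this symmetry also makes
  orbit closures invariant: if \<open>\<tau>\<close> lies in the orbit closure of \<open>\<sigma>\<close>, then \<open>\<sigma>\<close> lies in the
  orbit closure of \<open>\<tau>\<close>, which is also that of \<open>\<xi> \<bullet> \<tau>\<close>, and a second use of symmetry puts
  \<open>\<xi> \<bullet> \<tau>\<close> into the orbit closure of \<open>\<sigma>\<close>. It also gives minimality, since a closed invariant
  set that contains \<open>\<tau>\<close> contains its orbit closure, hence \<open>\<sigma>\<close>, hence the orbit closure of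
  \<open>\<sigma>\<close> (\<open>minimal_orbit_closure\<close>).

  For compact orbits of an open groupoid, continuity of the action and openness of the source map
  work together: if
  \<open>\<xi> \<bullet> \<tau> \<in> V\<close> with \<open>V\<close> open, then every point near \<open>\<tau>\<close> is moved into \<open>V\<close> by some arrow
  in a compact neighbourhood of \<open>\<xi>\<close> (\<open>nearby_points_return\<close>). Every point of the orbit of \<open>\<sigma>\<close> can be moved to \<open>\<sigma>\<close>, so
  covering the orbit by finitely many neighbourhoods gives a compact set of arrows that moves each
  of its points into \<open>V\<close>; the inverses of these arrows show that the return set is syndetic.
\<close>

section \<open>Groupoids and their actions\<close>

context groupoid
begin

lemma units_subset_arrows: "units G \<subseteq> arrows G"
  using src_closed by (auto simp: units_def)

lemma src_unit: "x \<in> arrows G \<Longrightarrow> src G x \<in> units G"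
  by (simp add: units_def)

lemma inv_composable: "x \<in> arrows G \<Longrightarrow> (ginv G x, x) \<in> composable G"
  by (simp add: composable_def inv_closed src_inv)

lemma mul_inv_cancel_left:
  assumes "(x, y) \<in> composable G"
  shows "mul G (ginv G x) (mul G x y) = y"
proof -
  have x: "x \<in> arrows G" and y: "y \<in> arrows G" and xy: "src G x = rng G y"
    using assms by (auto simp: composable_def)
  have "mul G (ginv G x) (mul G x y) = mul G (mul G (ginv G x) x) y"
    using mul_assoc[OF inv_composable[OF x] assms] by simp
  also have "\<dots> = y"
    using x y by (simp add: mul_inv_left xy mul_unit_left)
  finally show ?thesis .
qed

end

context topological_groupoid
begin

lemma Hausdorff_unit_top: "Hausdorff_space (unit_top G)"
  by (simp add: unit_top_def Hausdorff_arrows Hausdorff_space_subtopology)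

text \<open>The source map is built from the continuous operations as \<open>\<xi> \<mapsto> \<xi>\<inverse> \<xi>\<close>.\<close>

lemma continuous_src: "continuous_map (gtop G) (unit_top G) (src G)"
proof -
  have "continuous_map (gtop G) (prod_topology (gtop G) (gtop G)) (\<lambda>x. (ginv G x, x))"
    by (intro continuous_map_pairedI continuous_inv continuous_map_id[unfolded id_def])
  then have "continuous_map (gtop G)
      (subtopology (prod_topology (gtop G) (gtop G)) (composable G)) (\<lambda>x. (ginv G x, x))"
    using inv_composable by (auto simp: continuous_map_in_subtopology arrows_def)
  from continuous_map_compose[OF this continuous_mul]
  have "continuous_map (gtop G) (gtop G) (\<lambda>x. mul G (ginv G x) x)"
    by (simp add: o_def)
  then have "continuous_map (gtop G) (gtop G) (src G)"
    by (rule continuous_map_eq) (simp add: mul_inv_left arrows_def)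
  then show ?thesis
    using src_unit by (auto simp: unit_top_def continuous_map_in_subtopology arrows_def)
qed

end

context continuous_groupoid_action
begin

lemma anchor_unit: "\<sigma> \<in> points S \<Longrightarrow> anchor S \<sigma> \<in> units G"
  using anchor_surj by blast

lemma act_closed: "(\<xi>, \<sigma>) \<in> actable G S \<Longrightarrow> act S \<xi> \<sigma> \<in> points S"
  using continuous_map_image_subset_topspace[OF continuous_act]
  by (fastforce simp: actable_def arrows_def points_def)

lemma anchor_of_act:
  assumes "(\<xi>, \<sigma>) \<in> actable G S"
  shows "anchor S (act S \<xi> \<sigma>) = rng G \<xi>"
proof -
  have \<xi>: "\<xi> \<in> arrows G"
    using assms by (simp add: actable_def)
  then show ?thesis
    using anchor_act[OF inv_composable[OF \<xi>] assms] by (simp add: src_inv)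
qed

lemma inv_actable:
  assumes "(\<xi>, \<sigma>) \<in> actable G S"
  shows "(ginv G \<xi>, act S \<xi> \<sigma>) \<in> actable G S"
proof -
  have "\<xi> \<in> arrows G"
    using assms by (simp add: actable_def)
  then show ?thesis
    using act_closed[OF assms] anchor_of_act[OF assms]
    by (simp add: actable_def inv_closed src_inv)
qed

lemma act_inv:
  assumes "(\<xi>, \<sigma>) \<in> actable G S"
  shows "act S (ginv G \<xi>) (act S \<xi> \<sigma>) = \<sigma>"
proof -
  have \<xi>: "\<xi> \<in> arrows G" and \<sigma>: "\<sigma> \<in> points S" and eq: "src G \<xi> = anchor S \<sigma>"
    using assms by (auto simp: actable_def)
  have "act S (ginv G \<xi>) (act S \<xi> \<sigma>) = act S (mul G (ginv G \<xi>) \<xi>) \<sigma>"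
    using act_mul[OF inv_composable[OF \<xi>] assms] by simp
  also have "\<dots> = \<sigma>"
    by (simp add: mul_inv_left[OF \<xi>] eq act_unit[OF \<sigma>])
  finally show ?thesis .
qed

lemma mem_orbit_iff:
  assumes "\<sigma> \<in> points S"
  shows "\<tau> \<in> orbit G S \<sigma> \<longleftrightarrow> (\<exists>\<xi>. (\<xi>, \<sigma>) \<in> actable G S \<and> \<tau> = act S \<xi> \<sigma>)"
  using assms by (auto simp: orbit_def src_fibre_def actable_def)

lemma orbit_subset_points: "\<sigma> \<in> points S \<Longrightarrow> orbit G S \<sigma> \<subseteq> points S"
  using act_closed by (auto simp: mem_orbit_iff)

lemma orbit_refl: "\<sigma> \<in> points S \<Longrightarrow> \<sigma> \<in> orbit G S \<sigma>"
  using anchor_unit units_subset_arrows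
  by (force simp: mem_orbit_iff actable_def src_of_unit act_unit intro!: exI[of _ "anchor S \<sigma>"])

lemma orbit_sym:
  assumes "\<sigma> \<in> points S" "\<tau> \<in> orbit G S \<sigma>"
  shows "\<sigma> \<in> orbit G S \<tau>"
proof -
  obtain \<xi> where "(\<xi>, \<sigma>) \<in> actable G S" "\<tau> = act S \<xi> \<sigma>"
    using assms by (auto simp: mem_orbit_iff)
  then show ?thesis
    using inv_actable[of \<xi> \<sigma>] act_inv[of \<xi> \<sigma>] act_closed[of \<xi> \<sigma>]
    by (metis mem_orbit_iff)
qed

lemma orbit_trans:
  assumes "\<sigma> \<in> points S" "\<tau> \<in> orbit G S \<sigma>" "\<upsilon> \<in> orbit G S \<tau>"
  shows "\<upsilon> \<in> orbit G S \<sigma>"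
proof -
  obtain \<eta> where \<eta>: "(\<eta>, \<sigma>) \<in> actable G S" "\<tau> = act S \<eta> \<sigma>"
    using assms by (auto simp: mem_orbit_iff)
  obtain \<xi> where \<xi>: "(\<xi>, \<tau>) \<in> actable G S" "\<upsilon> = act S \<xi> \<tau>"
    using assms orbit_subset_points by (metis mem_orbit_iff subsetD)
  have c: "(\<xi>, \<eta>) \<in> composable G"
    using \<eta> \<xi> anchor_of_act[OF \<eta>(1)] by (auto simp: composable_def actable_def)
  have "(mul G \<xi> \<eta>, \<sigma>) \<in> actable G S"
    using \<eta>(1) mul_closed[OF c] src_mul[OF c] by (auto simp: actable_def)
  moreover have "\<upsilon> = act S (mul G \<xi> \<eta>) \<sigma>"
    using act_mul[OF c \<eta>(1)] \<eta> \<xi> by simp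
  ultimately show ?thesis
    using assms(1) mem_orbit_iff by blast
qed

lemma orbit_eq:
  assumes "\<sigma> \<in> points S" "\<tau> \<in> orbit G S \<sigma>"
  shows "orbit G S \<tau> = orbit G S \<sigma>"
  using assms orbit_sym orbit_trans orbit_subset_points by (meson subsetD subsetI subset_antisym)

lemma invariant_iff_orbits:
  "invariant G S M \<longleftrightarrow> M \<subseteq> points S \<and> (\<forall>\<tau>\<in>M. orbit G S \<tau> \<subseteq> M)"
  by (auto simp: invariant_def orbit_def src_fibre_def)

lemma orbit_subset_orbit_closure: "\<sigma> \<in> points S \<Longrightarrow> orbit G S \<sigma> \<subseteq> orbit_closure G S \<sigma>"
  using orbit_subset_points by (simp add: orbit_closure_def closure_of_subset points_def)

lemma orbit_closure_subset_points: "orbit_closure G S \<sigma> \<subseteq> points S"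
  by (simp add: orbit_closure_def points_def closure_of_subset_topspace)

lemma orbit_closure_subset_closed_invariant:
  assumes "closedin (stop S) N" "invariant G S N" "\<tau> \<in> N"
  shows "orbit_closure G S \<tau> \<subseteq> N"
  unfolding orbit_closure_def using assms
  by (intro closure_of_minimal) (auto simp: invariant_iff_orbits)

text \<open>
  The common criterion for the closed-orbit and the almost periodic case: a non-empty closed
  invariant subset contains the orbit closure of each of its points, hence \<open>\<sigma>\<close> by symmetry,
  hence everything.
\<close>

lemma minimal_orbit_closure:
  assumes "\<sigma> \<in> points S" "invariant G S (orbit_closure G S \<sigma>)"
    and sym: "\<And>\<tau>. \<tau> \<in> orbit_closure G S \<sigma> \<Longrightarrow> \<sigma> \<in> orbit_closure G S \<tau>"
  shows "minimal G S (orbit_closure G S \<sigma>)"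
  unfolding minimal_def
proof (intro conjI)
  show "orbit_closure G S \<sigma> \<noteq> {}"
    using assms(1) orbit_refl orbit_subset_orbit_closure by blast
  show "closedin (stop S) (orbit_closure G S \<sigma>)"
    by (simp add: orbit_closure_def)
  show "invariant G S (orbit_closure G S \<sigma>)"
    by fact
  show "\<not> (\<exists>N. N \<subset> orbit_closure G S \<sigma> \<and> N \<noteq> {} \<and> closedin (stop S) N \<and> invariant G S N)"
  proof
    assume "\<exists>N. N \<subset> orbit_closure G S \<sigma> \<and> N \<noteq> {} \<and> closedin (stop S) N \<and> invariant G S N"
    then obtain N \<tau> where N: "N \<subset> orbit_closure G S \<sigma>" "closedin (stop S) N" "invariant G S N"
      and \<tau>: "\<tau> \<in> N"
      by blast
    have "\<sigma> \<in> N"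
      using sym \<tau> N orbit_closure_subset_closed_invariant by blast
    then show False
      using N orbit_closure_subset_closed_invariant by blast
  qed
qed

text \<open>
  The set of pairs on which the action is defined is the equalizer of two continuous maps into
  the Hausdorff unit space, hence closed; so compact sets stay compact under the action.
\<close>

lemma closedin_actable: "closedin (prod_topology (gtop G) (stop S)) (actable G S)"
proof -
  have "closedin (prod_topology (gtop G) (stop S))
      {p \<in> topspace (prod_topology (gtop G) (stop S)). (src G \<circ> fst) p = (anchor S \<circ> snd) p}"
    by (intro closedin_continuous_maps_eq[OF Hausdorff_unit_top]
        continuous_map_compose[OF continuous_map_fst continuous_src]
        continuous_map_compose[OF continuous_map_snd continuous_anchor])
  moreover have "{p \<in> topspace (prod_topology (gtop G) (stop S)).
      (src G \<circ> fst) p = (anchor S \<circ> snd) p} = actable G S"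
    by (auto simp: actable_def arrows_def points_def)
  ultimately show ?thesis
    by simp
qed

lemma compactin_act_image:
  assumes "compactin (gtop G) K" "compactin (stop S) U"
  shows "compactin (stop S) ((\<lambda>(\<xi>, \<sigma>). act S \<xi> \<sigma>) ` (actable G S \<inter> K \<times> U))"
proof -
  have "compactin (prod_topology (gtop G) (stop S)) (K \<times> U)"
    using assms by (simp add: compactin_Times)
  then have "compactin (prod_topology (gtop G) (stop S)) (actable G S \<inter> K \<times> U)"
    by (rule closed_Int_compactin[OF closedin_actable])
  then have "compactin (subtopology (prod_topology (gtop G) (stop S)) (actable G S))
      (actable G S \<inter> K \<times> U)"
    by (simp add: compactin_subtopology)
  then show ?thesis
    using image_compactin continuous_act by blast
qed

section \<open>Closed orbits\<close>

lemma closed_orbits_imp_semisimple: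
  assumes closed: "\<And>\<sigma>. \<sigma> \<in> points S \<Longrightarrow> closedin (stop S) (orbit G S \<sigma>)"
  shows "semisimple G S"
  unfolding semisimple_def
proof
  fix \<sigma> assume \<sigma>: "\<sigma> \<in> points S"
  have eq: "orbit_closure G S \<tau> = orbit G S \<tau>" if "\<tau> \<in> points S" for \<tau>
    using closed[OF that] by (simp add: orbit_closure_def closure_of_closedin)
  show "minimal G S (orbit_closure G S \<sigma>)"
  proof (rule minimal_orbit_closure[OF \<sigma>])
    show "invariant G S (orbit_closure G S \<sigma>)"
      using orbit_subset_points[OF \<sigma>] orbit_trans[OF \<sigma>]
      unfolding eq[OF \<sigma>] invariant_iff_orbits by blast
    fix \<tau> assume \<tau>: "\<tau> \<in> orbit_closure G S \<sigma>"
    then have "\<tau> \<in> points S"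
      using orbit_closure_subset_points by blast
    then show "\<sigma> \<in> orbit_closure G S \<tau>"
      using \<tau> \<sigma> by (simp add: eq orbit_sym)
  qed
qed

section \<open>Almost periodic points\<close>

text \<open>
  Factoring an arrow \<open>\<xi>\<close> out of \<open>anchor S \<sigma>\<close> as \<open>k \<eta>\<close> with \<open>\<eta> \<bullet> \<sigma> \<in> U\<close> turns
  \<open>\<xi> \<bullet> \<sigma>\<close> into \<open>k \<bullet> (\<eta> \<bullet> \<sigma>) \<in> K \<bullet> U\<close>.
\<close>

lemma return_set_syndetic_imp_orbit_subset:
  assumes \<sigma>: "\<sigma> \<in> points S"
    and K: "set_mul G K (return_set G S \<sigma> U) = src_fibre G (anchor S \<sigma>)" "K \<subseteq> arrows G"
  shows "orbit G S \<sigma> \<subseteq> (\<lambda>(\<xi>, \<sigma>). act S \<xi> \<sigma>) ` (actable G S \<inter> K \<times> U)"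
proof
  fix \<tau> assume "\<tau> \<in> orbit G S \<sigma>"
  then obtain \<xi> where \<xi>: "\<xi> \<in> src_fibre G (anchor S \<sigma>)" "\<tau> = act S \<xi> \<sigma>"
    by (auto simp: orbit_def)
  then obtain k \<eta> where k: "k \<in> K" "\<eta> \<in> return_set G S \<sigma> U" "src G k = rng G \<eta>"
      "\<xi> = mul G k \<eta>"
    by (auto simp: K(1)[symmetric] set_mul_def)
  have \<eta>: "(\<eta>, \<sigma>) \<in> actable G S" and U: "act S \<eta> \<sigma> \<in> U"
    using k(2) \<sigma> by (auto simp: return_set_def src_fibre_def actable_def)
  have c: "(k, \<eta>) \<in> composable G"
    using k \<eta> K(2) by (auto simp: composable_def actable_def)
  have "(k, act S \<eta> \<sigma>) \<in> actable G S"
    using k K(2) act_closed[OF \<eta>] anchor_of_act[OF \<eta>] by (auto simp: actable_def)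
  moreover have "\<tau> = act S k (act S \<eta> \<sigma>)"
    using act_mul[OF c \<eta>] \<xi>(2) k(4) by simp
  ultimately show "\<tau> \<in> (\<lambda>(\<xi>, \<sigma>). act S \<xi> \<sigma>) ` (actable G S \<inter> K \<times> U)"
    using k(1) U by force
qed

text \<open>
  The orbit closure of an almost periodic point \<open>\<sigma>\<close> is covered by the compact set \<open>K \<bullet> U\<close>, for
  each compact neighbourhood \<open>U\<close> of \<open>\<sigma>\<close> and a suitable compact \<open>K\<close>. This is why each point of
  the orbit closure has an orbit returning to \<open>U\<close>.
\<close>

lemma orbit_closure_sym:
  assumes lc: "locally_compact_space (stop S)"
    and \<sigma>: "\<sigma> \<in> points S" and ap: "almost_periodic G S \<sigma>"
    and \<tau>: "\<tau> \<in> orbit_closure G S \<sigma>"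
  shows "\<sigma> \<in> orbit_closure G S \<tau>"
  unfolding orbit_closure_def in_closure_of
proof (intro conjI allI impI)
  show "\<sigma> \<in> topspace (stop S)"
    using \<sigma> by (simp add: points_def)
  fix W assume W: "\<sigma> \<in> W \<and> openin (stop S) W"
  have "neighbourhood_base_of (compactin (stop S)) (stop S)"
    using lc Hausdorff_points locally_compact_space_neighbourhood_base by blast
  then obtain V U where U: "openin (stop S) V" "compactin (stop S) U" "\<sigma> \<in> V" "V \<subseteq> U" "U \<subseteq> W"
    using W unfolding neighbourhood_base_of by metis
  then have "nbhd (stop S) \<sigma> U"
    by (auto simp: nbhd_def dest: compactin_subset_topspace)
  then obtain K where K: "compactin (gtop G) K"
      "set_mul G K (return_set G S \<sigma> U) = src_fibre G (anchor S \<sigma>)"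
    using ap by (auto simp: almost_periodic_def syndetic_def)
  let ?KU = "(\<lambda>(\<xi>, \<sigma>). act S \<xi> \<sigma>) ` (actable G S \<inter> K \<times> U)"
  have "closedin (stop S) ?KU"
    using compactin_imp_closedin[OF Hausdorff_points] compactin_act_image K(1) U(2) by blast
  moreover have "orbit G S \<sigma> \<subseteq> ?KU"
    using return_set_syndetic_imp_orbit_subset[OF \<sigma> K(2)] compactin_subset_topspace[OF K(1)]
    by (simp add: arrows_def)
  ultimately have "orbit_closure G S \<sigma> \<subseteq> ?KU"
    unfolding orbit_closure_def by (rule closure_of_minimal[rotated])
  then obtain k u where k: "(k, u) \<in> actable G S" "u \<in> U" "\<tau> = act S k u"
    using \<tau> by auto
  have u: "u \<in> points S"
    using k(1) by (simp add: actable_def)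
  then have "u \<in> orbit G S \<tau>"
    using k orbit_sym mem_orbit_iff by blast
  then show "\<exists>y. y \<in> orbit G S \<tau> \<and> y \<in> W"
    using k(2) U(5) by blast
qed

lemma pointwise_almost_periodic_imp_semisimple:
  assumes lc: "locally_compact_space (stop S)" and pap: "pointwise_almost_periodic G S"
  shows "semisimple G S"
  unfolding semisimple_def
proof
  have sym: "\<sigma> \<in> orbit_closure G S \<tau>"
    if "\<sigma> \<in> points S" "\<tau> \<in> orbit_closure G S \<sigma>" for \<sigma> \<tau>
    using orbit_closure_sym[OF lc that(1) _ that(2)] pap that(1)
    by (simp add: pointwise_almost_periodic_def)
  fix \<sigma> assume \<sigma>: "\<sigma> \<in> points S"
  have "\<upsilon> \<in> orbit_closure G S \<sigma>"
    if \<tau>: "\<tau> \<in> orbit_closure G S \<sigma>" and \<upsilon>: "\<upsilon> \<in> orbit G S \<tau>" for \<tau> \<upsilon>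
  proof -
    have \<tau>': "\<tau> \<in> points S"
      using \<tau> orbit_closure_subset_points by blast
    have "orbit_closure G S \<upsilon> = orbit_closure G S \<tau>"
      using orbit_eq[OF \<tau>' \<upsilon>] by (simp add: orbit_closure_def)
    then have "\<sigma> \<in> orbit_closure G S \<upsilon>"
      using sym[OF \<sigma> \<tau>] by simp
    then show ?thesis
      using sym \<upsilon> \<tau>' orbit_subset_points by blast
  qed
  then have "invariant G S (orbit_closure G S \<sigma>)"
    using orbit_closure_subset_points by (auto simp: invariant_iff_orbits)
  then show "minimal G S (orbit_closure G S \<sigma>)"
    using minimal_orbit_closure[OF \<sigma>] sym[OF \<sigma>] by blast
qed

section \<open>Compact orbits of open groupoids\<close>

text \<open>
  Continuity of the action at \<open>(\<xi>, \<tau>)\<close> alone does not suffice: for \<open>\<tau>'\<close> near \<open>\<tau>\<close> there must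
  exist an arrow near \<open>\<xi>\<close> whose source is the anchor of \<open>\<tau>'\<close>. Openness of the source map
  provides it.
\<close>

lemma nearby_points_return:
  assumes lc: "locally_compact_space (gtop G)" and op: "open_groupoid G"
    and \<xi>: "(\<xi>, \<tau>) \<in> actable G S" and V: "openin (stop S) V" "act S \<xi> \<tau> \<in> V"
  obtains K Q where "compactin (gtop G) K" "openin (stop S) Q" "\<tau> \<in> Q"
    "\<And>\<tau>'. \<tau>' \<in> Q \<Longrightarrow> \<exists>\<xi>'\<in>K. (\<xi>', \<tau>') \<in> actable G S \<and> act S \<xi>' \<tau>' \<in> V"
proof -
  have a: "\<xi> \<in> arrows G" "\<tau> \<in> points S" "src G \<xi> = anchor S \<tau>"
    using \<xi> by (auto simp: actable_def)
  obtain P0 K where P0: "openin (gtop G) P0" "compactin (gtop G) K" "\<xi> \<in> P0" "P0 \<subseteq> K"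
    using lc a(1) by (auto simp: locally_compact_space_def arrows_def)
  let ?A = "subtopology (prod_topology (gtop G) (stop S)) (actable G S)"
  have "openin ?A {p \<in> topspace ?A. (\<lambda>(\<xi>, \<sigma>). act S \<xi> \<sigma>) p \<in> V}"
    by (rule openin_continuous_map_preimage[OF continuous_act V(1)])
  then obtain T where T: "openin (prod_topology (gtop G) (stop S)) T"
      "{p \<in> topspace ?A. (\<lambda>(\<xi>, \<sigma>). act S \<xi> \<sigma>) p \<in> V} = T \<inter> actable G S"
    by (auto simp: openin_subtopology)
  have "(\<xi>, \<tau>) \<in> {p \<in> topspace ?A. (\<lambda>(\<xi>, \<sigma>). act S \<xi> \<sigma>) p \<in> V}"
    using \<xi> V(2) a by (simp add: arrows_def points_def)
  then have "(\<xi>, \<tau>) \<in> T"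
    using T(2) by blast
  then obtain P1 Q1 where PQ: "openin (gtop G) P1" "openin (stop S) Q1" "\<xi> \<in> P1" "\<tau> \<in> Q1"
      "P1 \<times> Q1 \<subseteq> T"
    using T(1) unfolding openin_prod_topology_alt by metis
  \<comment> \<open>\<open>P0\<close> keeps the arrows in a compact set and \<open>P1\<close> keeps their action in \<open>V\<close>.\<close>
  let ?P = "P0 \<inter> P1"
  have "openin (unit_top G) (src G ` ?P)"
    using op P0(1) PQ(1) by (auto simp: open_groupoid_def open_map_def)
  then have "openin (stop S) {\<tau>' \<in> topspace (stop S). anchor S \<tau>' \<in> src G ` ?P}"
    by (rule openin_continuous_map_preimage[OF continuous_anchor])
  then have "openin (stop S) (Q1 \<inter> {\<tau>' \<in> topspace (stop S). anchor S \<tau>' \<in> src G ` ?P})"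
    using PQ(2) by blast
  moreover have "\<tau> \<in> Q1 \<inter> {\<tau>' \<in> topspace (stop S). anchor S \<tau>' \<in> src G ` ?P}"
    using PQ(3,4) P0(3) a by (auto simp: points_def simp flip: a(3))
  moreover have "\<exists>\<xi>'\<in>K. (\<xi>', \<tau>') \<in> actable G S \<and> act S \<xi>' \<tau>' \<in> V"
    if \<tau>': "\<tau>' \<in> Q1 \<inter> {\<tau>' \<in> topspace (stop S). anchor S \<tau>' \<in> src G ` ?P}" for \<tau>'
  proof -
    obtain \<xi>' where \<xi>': "\<xi>' \<in> ?P" "anchor S \<tau>' = src G \<xi>'"
      using \<tau>' by auto
    have "(\<xi>', \<tau>') \<in> actable G S"
      using \<tau>' \<xi>' openin_subset[OF P0(1)] by (auto simp: actable_def arrows_def points_def)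
    moreover from this have "(\<xi>', \<tau>') \<in> T \<inter> actable G S"
      using PQ(5) \<xi>' \<tau>' by auto
    then have "act S \<xi>' \<tau>' \<in> V"
      unfolding T(2)[symmetric] by auto
    ultimately show ?thesis
      using \<xi>' P0(4) by auto
  qed
  ultimately show thesis
    using that P0(2) by blast
qed

text \<open>
  If finitely many compact sets of arrows together move every point of the orbit into \<open>V\<close>, then
  each \<open>\<eta>\<close> out of \<open>anchor S \<sigma>\<close> has some \<open>\<xi>\<close> in their union with \<open>\<xi> \<eta>\<close> in the return set,
  and \<open>\<eta> = \<xi>\<inverse> (\<xi> \<eta>)\<close>. The inverses of that union therefore witness syndeticity.
\<close>

lemma compact_orbit_imp_almost_periodic:
  assumes lc: "locally_compact_space (gtop G)" and op: "open_groupoid G"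
    and \<sigma>: "\<sigma> \<in> points S" and comp: "compactin (stop S) (orbit G S \<sigma>)"
  shows "almost_periodic G S \<sigma>"
  unfolding almost_periodic_def
proof (intro allI impI)
  fix U assume "nbhd (stop S) \<sigma> U"
  then obtain V where V: "openin (stop S) V" "\<sigma> \<in> V" "V \<subseteq> U"
    by (auto simp: nbhd_def)
  have "\<exists>K Q. compactin (gtop G) K \<and> openin (stop S) Q \<and> \<tau> \<in> Q \<and>
      (\<forall>\<tau>'\<in>Q. \<exists>\<xi>'\<in>K. (\<xi>', \<tau>') \<in> actable G S \<and> act S \<xi>' \<tau>' \<in> V)"
    if \<tau>: "\<tau> \<in> orbit G S \<sigma>" for \<tau>
  proof -
    have "\<tau> \<in> points S"
      using \<tau> \<sigma> orbit_subset_points by blast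
    then obtain \<xi> where "(\<xi>, \<tau>) \<in> actable G S" "act S \<xi> \<tau> = \<sigma>"
      using orbit_sym[OF \<sigma> \<tau>] mem_orbit_iff by metis
    then show ?thesis
      using nearby_points_return[OF lc op _ V(1)] V(2) by metis
  qed
  then obtain K Q where KQ: "\<And>\<tau>. \<tau> \<in> orbit G S \<sigma> \<Longrightarrow>
      compactin (gtop G) (K \<tau>) \<and> openin (stop S) (Q \<tau>) \<and> \<tau> \<in> Q \<tau> \<and>
      (\<forall>\<tau>'\<in>Q \<tau>. \<exists>\<xi>'\<in>K \<tau>. (\<xi>', \<tau>') \<in> actable G S \<and> act S \<xi>' \<tau>' \<in> V)"
    by metis
  obtain F where F: "finite F" "F \<subseteq> orbit G S \<sigma>" "orbit G S \<sigma> \<subseteq> (\<Union>\<tau>\<in>F. Q \<tau>)"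
  proof -
    have "\<exists>\<F>. finite \<F> \<and> \<F> \<subseteq> Q ` orbit G S \<sigma> \<and> orbit G S \<sigma> \<subseteq> \<Union>\<F>"
      using KQ by (intro compactinD[OF comp]) auto
    then show thesis
      using that finite_subset_image by (metis (no_types, lifting))
  qed
  define L where "L = ginv G ` (\<Union>\<tau>\<in>F. K \<tau>)"
  have "compactin (gtop G) (\<Union>\<tau>\<in>F. K \<tau>)"
    using F KQ by (intro compactin_Union) auto
  then have L: "compactin (gtop G) L"
    unfolding L_def using image_compactin continuous_inv by blast
  have "set_mul G L (return_set G S \<sigma> U) \<subseteq> src_fibre G (anchor S \<sigma>)"
  proof
    fix \<zeta> assume "\<zeta> \<in> set_mul G L (return_set G S \<sigma> U)"
    then obtain k \<eta> where k: "k \<in> L" "\<eta> \<in> src_fibre G (anchor S \<sigma>)" "src G k = rng G \<eta>"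
        "\<zeta> = mul G k \<eta>"
      by (auto simp: set_mul_def return_set_def)
    have c: "(k, \<eta>) \<in> composable G"
      using k compactin_subset_topspace[OF L]
      by (auto simp: composable_def src_fibre_def arrows_def)
    then show "\<zeta> \<in> src_fibre G (anchor S \<sigma>)"
      using mul_closed[OF c] src_mul[OF c] k by (simp add: src_fibre_def)
  qed
  moreover have "src_fibre G (anchor S \<sigma>) \<subseteq> set_mul G L (return_set G S \<sigma> U)"
  proof
    fix \<eta> assume \<eta>: "\<eta> \<in> src_fibre G (anchor S \<sigma>)"
    then have a: "(\<eta>, \<sigma>) \<in> actable G S" "\<eta> \<in> arrows G"
      using \<sigma> by (auto simp: src_fibre_def actable_def)
    have "act S \<eta> \<sigma> \<in> orbit G S \<sigma>"
      using \<eta> by (auto simp: orbit_def)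
    then obtain \<tau> where \<tau>: "\<tau> \<in> F" "act S \<eta> \<sigma> \<in> Q \<tau>"
      using F(3) by auto
    then obtain \<xi> where \<xi>: "\<xi> \<in> K \<tau>" "(\<xi>, act S \<eta> \<sigma>) \<in> actable G S"
        "act S \<xi> (act S \<eta> \<sigma>) \<in> V"
      using KQ F(2) by blast
    have c: "(\<xi>, \<eta>) \<in> composable G"
      using \<xi>(2) a anchor_of_act[OF a(1)] by (simp add: composable_def actable_def)
    have "mul G \<xi> \<eta> \<in> return_set G S \<sigma> U"
      using mul_closed[OF c] src_mul[OF c] act_mul[OF c a(1)] \<xi>(3) V(3) \<eta>
      by (auto simp: return_set_def src_fibre_def)
    moreover have "ginv G \<xi> \<in> L"
      using \<xi>(1) \<tau>(1) by (auto simp: L_def)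
    moreover have "src G (ginv G \<xi>) = rng G (mul G \<xi> \<eta>)"
      using \<xi>(2) by (simp add: rng_mul[OF c] src_inv actable_def)
    moreover have "\<eta> = mul G (ginv G \<xi>) (mul G \<xi> \<eta>)"
      by (simp add: mul_inv_cancel_left[OF c])
    ultimately show "\<eta> \<in> set_mul G L (return_set G S \<sigma> U)"
      unfolding set_mul_def by blast
  qed
  ultimately show "syndetic G (anchor S \<sigma>) (return_set G S \<sigma> U)"
    using L by (auto simp: syndetic_def return_set_def)
qed

end

section \<open>Orbit closures and almost periodicity\<close>

theorem corollary6p28:
  fixes G :: "'g gpd" and S :: "('g, 's) gpd_action"
  assumes "continuous_groupoid_action G S"
    and "locally_compact_space (gtop G)"
    and "locally_compact_space (stop S)"
  shows "((\<forall>\<sigma> \<in> points S. closedin (stop S) (orbit G S \<sigma>)) \<longrightarrow> semisimple G S) \<and>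
    (pointwise_almost_periodic G S \<longrightarrow> semisimple G S) \<and>
    (open_groupoid G \<and> (\<forall>\<sigma> \<in> points S. compactin (stop S) (orbit G S \<sigma>)) \<longrightarrow>
      pointwise_almost_periodic G S)"
proof -
  interpret continuous_groupoid_action G S
    by fact
  show ?thesis
    using assms(2,3) closed_orbits_imp_semisimple pointwise_almost_periodic_imp_semisimple
      compact_orbit_imp_almost_periodic
    by (auto simp: pointwise_almost_periodic_def)
qed

end
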